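(* Let $a,b,c\in C^2(\Omega)$, $f\in C^1(\Omega\times\mathbb{R}^3)$, and $b^2(\mathbf{x})-a(\mathbf{x})c(\mathbf{x})>0$ for all $\mathbf{x}\in\Omega$. Let $u\in C^2(\Omega)$ be a solution in $\Omega$ of the hyperbolic equation $$\mathcal{A}u(\mathbf{x})=f(\mathbf{x},u(\mathbf{x}),\partial_{x_1}u(\mathbf{x}),\partial_{x_2}u(\mathbf{x})).$$ Then for every curvilinear characteristic parallelogram $\Pi=\{\mathbf{x}\mid \gamma_1(\mathbf{x})\in[l_1,l_2]\ \text{and}\ \gamma_2(\mathbf{x})\in[r_1,r_2]\}\subseteq\Omega$ with vertices $$A=(\gamma_1^{-1}(l_1,r_1),\gamma_2^{-1}(l_1,r_1)),\quad B=(\gamma_1^{-1}(l_1,r_2),\gamma_2^{-1}(l_1,r_2)),$$ $$C=(\gamma_1^{-1}(l_2,r_2),\gamma_2^{-1}(l_2,r_2)),\quad D=(\gamma_1^{-1}(l_2,r_1),\gamma_2^{-1}(l_2,r_1)),$$ the following equality holds: $$u(A)-u(B)+u(C)-u(D)=\int_{l_1}^{l_2}dz_1\int_{r_1}^{r_2}\widetilde{K}\Big(\mathbf{z},\,u(\gamma_1^{-1}(\mathbf{z}),\gamma_2^{-1}(\mathbf{z})),\,\partial_{x_1}u(\gamma_1^{-1}(\mathbf{z}),\gamma_2^{-1}(\mathbf{z})),\,\partial_{x_2}u(\gamma_1^{-1}(\mathbf{z}),\gamma_2^{-1}(\mathbf{z}))\Big)\,dz_2 .$$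
   Context: $\Omega\subseteq\mathbb{R}^2$ is a domain (open connected set), with points $\mathbf{x}=(x_1,x_2)$; all functions are real-valued. For coefficient functions $a,b,c:\Omega\to\mathbb{R}$ the operator $\mathcal{A}$ is $$\mathcal{A}w=a\,\partial_{x_1}^2w+2b\,\partial_{x_1}\partial_{x_2}w+c\,\partial_{x_2}^2w .$$ Characteristics: $\gamma_1,\gamma_2\in C^2(\Omega)$ are two fixed first integrals of the characteristic ordinary differential equation $a\,(dx_2)^2-2b\,dx_1dx_2+c\,(dx_1)^2=0$, i.e. solutions in $\Omega$ of $$a(\partial_{x_1}\gamma_i)^2+2b\,\partial_{x_1}\gamma_i\,\partial_{x_2}\gamma_i+c(\partial_{x_2}\gamma_i)^2=0,\quad i=1,2,$$ that are functionally independent: the Jacobian determinant of $(\gamma_1,\gamma_2)$ with respect to $(x_1,x_2)$ is nonzero at every point of $\Omega$. The change of variables $y_1=\gamma_1(x_1,x_2)$, $y_2=\gamma_2(x_1,x_2)$ is assumed invertible (from $\Omega$ onto its image), and its inverse is written $x_1=\gamma_1^{-1}(y_1,y_2)$, $x_2=\gamma_2^{-1}(y_1,y_2)$. So $\gamma_1^{-1},\gamma_2^{-1}$ denote the two components of the inverse map, as functions of $\mathbf{y}=(y_1,y_2)$ (or of $\mathbf{z}=(z_1,z_2)$), and $\partial_{y_j}\gamma_i^{-1}$ is the partial derivative in the $j$-th argument. A curvilinear characteristic parallelogram is a set $\Pi=\{\mathbf{x}\mid\gamma_1(\mathbf{x})\in[l_1,l_2]\text{ and }\gamma_2(\mathbf{x})\in[r_1,r_2]\}$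 with real $l_1<l_2$, $r_1<r_2$, where the rectangle $[l_1,l_2]\times[r_1,r_2]$ is contained in the image of $\Omega$ under $(\gamma_1,\gamma_2)$. Its vertices are the points where $\gamma_1=l_i$ and $\gamma_2=r_j$, $i,j\in\{1,2\}$. Notation: $$\beta=2\big(a\,\partial_{x_1}\gamma_1\partial_{x_1}\gamma_2+b(\partial_{x_2}\gamma_2\partial_{x_1}\gamma_1+\partial_{x_2}\gamma_1\partial_{x_1}\gamma_2)+c\,\partial_{x_2}\gamma_1\partial_{x_2}\gamma_2\big)$$ (a function on $\Omega$), and for $p,q,r\in\mathbb{R}$, $$K(\mathbf{z},p,q,r)=f(\gamma_1^{-1}(\mathbf{z}),\gamma_2^{-1}(\mathbf{z}),p,q,r)-(\mathcal{A}\gamma_1)(\gamma_1^{-1}(\mathbf{z}),\gamma_2^{-1}(\mathbf{z}))\big(q\,\partial_{y_1}\gamma_1^{-1}(\mathbf{z})+r\,\partial_{y_1}\gamma_2^{-1}(\mathbf{z})\big)-(\mathcal{A}\gamma_2)(\gamma_1^{-1}(\mathbf{z}),\gamma_2^{-1}(\mathbf{z}))\big(q\,\partial_{y_2}\gamma_1^{-1}(\mathbf{z})+r\,\partial_{y_2}\gamma_2^{-1}(\mathbf{z})\big),$$ $$\widetilde{K}(\mathbf{z},p,q,r)=\frac{K(\mathbf{z},p,q,r)}{\beta(\gamma_1^{-1}(\mathbf{z}),\gamma_2^{-1}(\mathbf{z}))}.$$ *)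

theory Defs
  imports "HOL-Analysis.Analysis"
begin

definition partial_deriv :: "'a::euclidean_space \<Rightarrow> ('a \<Rightarrow> real) \<Rightarrow> 'a \<Rightarrow> real" where
  "partial_deriv e g x = deriv (\<lambda>t. g (x + t *\<^sub>R e)) 0"

text \<open>The class \<open>C^k(S)\<close>, meant for open \<open>S\<close>: all partial derivatives of order at most \<open>k\<close>
  exist and are continuous on \<open>S\<close>. Only values of \<open>g\<close> near points of \<open>S\<close> matter.\<close>

primrec Ck_on :: "nat \<Rightarrow> 'a::euclidean_space set \<Rightarrow> ('a \<Rightarrow> real) \<Rightarrow> bool" where
  "Ck_on 0 S g \<longleftrightarrow> continuous_on S g"
| "Ck_on (Suc k) S g \<longleftrightarrow> continuous_on S g \<and>
     (\<forall>e\<in>Basis. (\<forall>x\<in>S. (\<lambda>t. g (x + t *\<^sub>R e)) field_differentiable at 0) \<and>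
                Ck_on k S (partial_deriv e g))"

type_synonym plane = "real \<times> real"

abbreviation D1 :: "(plane \<Rightarrow> real) \<Rightarrow> plane \<Rightarrow> real" where
  "D1 \<equiv> partial_deriv (1, 0)"

abbreviation D2 :: "(plane \<Rightarrow> real) \<Rightarrow> plane \<Rightarrow> real" where
  "D2 \<equiv> partial_deriv (0, 1)"

definition op_A ::
  "(plane \<Rightarrow> real) \<Rightarrow> (plane \<Rightarrow> real) \<Rightarrow> (plane \<Rightarrow> real) \<Rightarrow> (plane \<Rightarrow> real) \<Rightarrow> plane \<Rightarrow> real" where
  "op_A a b c w x = a x * D1 (D1 w) x + 2 * b x * D1 (D2 w) x + c x * D2 (D2 w) x"

definition first_integral ::
  "plane set \<Rightarrow> (plane \<Rightarrow> real) \<Rightarrow> (plane \<Rightarrow> real) \<Rightarrow> (plane \<Rightarrow> real) \<Rightarrow> (plane \<Rightarrow> real) \<Rightarrow> bool" where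
  "first_integral \<Omega> a b c \<gamma> \<longleftrightarrow>
     (\<forall>x\<in>\<Omega>. a x * (D1 \<gamma> x)\<^sup>2 + 2 * b x * D1 \<gamma> x * D2 \<gamma> x + c x * (D2 \<gamma> x)\<^sup>2 = 0)"

definition jacobian_det :: "(plane \<Rightarrow> real) \<Rightarrow> (plane \<Rightarrow> real) \<Rightarrow> plane \<Rightarrow> real" where
  "jacobian_det \<gamma>1 \<gamma>2 x = D1 \<gamma>1 x * D2 \<gamma>2 x - D2 \<gamma>1 x * D1 \<gamma>2 x"

definition char_map :: "(plane \<Rightarrow> real) \<Rightarrow> (plane \<Rightarrow> real) \<Rightarrow> plane \<Rightarrow> plane" where
  "char_map \<gamma>1 \<gamma>2 x = (\<gamma>1 x, \<gamma>2 x)"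

text \<open>The inverse of the change of variables from \<open>\<Omega>\<close> onto its image, and its two components
  (written \<open>\<gamma>\<^sub>1\<close> and \<open>\<gamma>\<^sub>2\<close> with exponent -1 in the usual notation, although they are not inverses
  of the individual \<open>\<gamma>\<^sub>i\<close>). The values are meaningful only on the image of \<open>\<Omega>\<close>.\<close>

definition char_inv :: "plane set \<Rightarrow> (plane \<Rightarrow> real) \<Rightarrow> (plane \<Rightarrow> real) \<Rightarrow> plane \<Rightarrow> plane" where
  "char_inv \<Omega> \<gamma>1 \<gamma>2 = inv_into \<Omega> (char_map \<gamma>1 \<gamma>2)"

definition char_inv1 :: "plane set \<Rightarrow> (plane \<Rightarrow> real) \<Rightarrow> (plane \<Rightarrow> real) \<Rightarrow> plane \<Rightarrow> real" where
  "char_inv1 \<Omega> \<gamma>1 \<gamma>2 y = fst (char_inv \<Omega> \<gamma>1 \<gamma>2 y)"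

definition char_inv2 :: "plane set \<Rightarrow> (plane \<Rightarrow> real) \<Rightarrow> (plane \<Rightarrow> real) \<Rightarrow> plane \<Rightarrow> real" where
  "char_inv2 \<Omega> \<gamma>1 \<gamma>2 y = snd (char_inv \<Omega> \<gamma>1 \<gamma>2 y)"

definition char_parallelogram ::
  "plane set \<Rightarrow> (plane \<Rightarrow> real) \<Rightarrow> (plane \<Rightarrow> real) \<Rightarrow> real \<Rightarrow> real \<Rightarrow> real \<Rightarrow> real \<Rightarrow> plane set \<Rightarrow> bool" where
  "char_parallelogram \<Omega> \<gamma>1 \<gamma>2 l1 l2 r1 r2 P \<longleftrightarrow>
     l1 < l2 \<and> r1 < r2 \<and> {l1..l2} \<times> {r1..r2} \<subseteq> char_map \<gamma>1 \<gamma>2 ` \<Omega> \<and>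
     P = {x \<in> \<Omega>. \<gamma>1 x \<in> {l1..l2} \<and> \<gamma>2 x \<in> {r1..r2}}"

definition char_beta ::
  "(plane \<Rightarrow> real) \<Rightarrow> (plane \<Rightarrow> real) \<Rightarrow> (plane \<Rightarrow> real) \<Rightarrow> (plane \<Rightarrow> real) \<Rightarrow> (plane \<Rightarrow> real)
    \<Rightarrow> plane \<Rightarrow> real" where
  "char_beta a b c \<gamma>1 \<gamma>2 x =
     2 * (a x * D1 \<gamma>1 x * D1 \<gamma>2 x
          + b x * (D2 \<gamma>2 x * D1 \<gamma>1 x + D2 \<gamma>1 x * D1 \<gamma>2 x)
          + c x * D2 \<gamma>1 x * D2 \<gamma>2 x)"

definition char_K ::
  "plane set \<Rightarrow> (plane \<Rightarrow> real) \<Rightarrow> (plane \<Rightarrow> real) \<Rightarrow> (plane \<Rightarrow> real)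
    \<Rightarrow> (plane \<times> real \<times> real \<times> real \<Rightarrow> real) \<Rightarrow> (plane \<Rightarrow> real) \<Rightarrow> (plane \<Rightarrow> real)
    \<Rightarrow> plane \<Rightarrow> real \<Rightarrow> real \<Rightarrow> real \<Rightarrow> real" where
  "char_K \<Omega> a b c f \<gamma>1 \<gamma>2 z p q r =
     (let g1 = char_inv1 \<Omega> \<gamma>1 \<gamma>2; g2 = char_inv2 \<Omega> \<gamma>1 \<gamma>2
      in f ((g1 z, g2 z), p, q, r)
         - op_A a b c \<gamma>1 (g1 z, g2 z) * (q * D1 g1 z + r * D1 g2 z)
         - op_A a b c \<gamma>2 (g1 z, g2 z) * (q * D2 g1 z + r * D2 g2 z))"

definition char_Ktilde ::
  "plane set \<Rightarrow> (plane \<Rightarrow> real) \<Rightarrow> (plane \<Rightarrow> real) \<Rightarrow> (plane \<Rightarrow> real)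
    \<Rightarrow> (plane \<times> real \<times> real \<times> real \<Rightarrow> real) \<Rightarrow> (plane \<Rightarrow> real) \<Rightarrow> (plane \<Rightarrow> real)
    \<Rightarrow> plane \<Rightarrow> real \<Rightarrow> real \<Rightarrow> real \<Rightarrow> real" where
  "char_Ktilde \<Omega> a b c f \<gamma>1 \<gamma>2 z p q r =
     char_K \<Omega> a b c f \<gamma>1 \<gamma>2 z p q r
     / char_beta a b c \<gamma>1 \<gamma>2 (char_inv1 \<Omega> \<gamma>1 \<gamma>2 z, char_inv2 \<Omega> \<gamma>1 \<gamma>2 z)"

end

theory Submission
  imports Defs
begin

text \<open>
  In the coordinates \<open>y = (\<gamma>1 x, \<gamma>2 x)\<close> the equation takes its canonical form
  \<open>v\<^sub>1\<^sub>2 = K\<close>, where \<open>v\<close> is \<open>u\<close> written as a function of \<open>y\<close> and \<open>K\<close> is the integrand of the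
  theorem. A characteristic parallelogram becomes a rectangle, and integrating a mixed derivative
  over a rectangle leaves the alternating sum of \<open>v\<close> over the four corners
  (\<open>integral_mixed_derivative\<close>).

  The direct route to the canonical form differentiates \<open>u(x) = v(\<gamma>1 x, \<gamma>2 x)\<close> twice and therefore
  asks whether \<open>v\<close>, hence the inverse change of variables, is of class \<open>C^2\<close>. The proof
  here avoids second derivatives of the inverse. By Cramer's rule the first derivatives
  \<open>v\<^sub>1, v\<^sub>2\<close>, read as functions of \<open>x\<close>, are explicit quotients of first derivatives
  of \<open>u, \<gamma>1, \<gamma>2\<close>; they are \<open>char_D1\<close> and \<open>char_D2\<close>, and they are visibly differentiable.
  One differentiates the identities \<open>\<nabla>u = v\<^sub>1 \<nabla>\<gamma>1 + v\<^sub>2 \<nabla>\<gamma>2\<close> on \<open>\<Omega>\<close>, and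
  Clairaut's theorem for \<open>u, \<gamma>1, \<gamma>2\<close> (\<open>C2_mixed_partials_commute\<close>) yields
  \<open>v\<^sub>1\<^sub>2 = v\<^sub>2\<^sub>1\<close>. In \<open>\<A>u\<close> the coefficients of \<open>v\<^sub>1\<^sub>1\<close> and \<open>v\<^sub>2\<^sub>2\<close> are the characteristic forms of
  \<open>\<gamma>1\<close> and \<open>\<gamma>2\<close>, which vanish; what remains is
  \<open>\<A>u = \<beta> v\<^sub>1\<^sub>2 + (\<A>\<gamma>1) v\<^sub>1 + (\<A>\<gamma>2) v\<^sub>2\<close> (\<open>canonical_form\<close>). Hyperbolicity makes \<open>\<beta>\<close> nonzero
  (\<open>char_beta_nonzero\<close>), so this can be solved for \<open>v\<^sub>1\<^sub>2\<close>. Only first derivatives of the inverse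
  are needed, and these come from the inverse function theorem (\<open>char_inv_has_derivative\<close>).
\<close>

section \<open>Functions of class \<open>C^1\<close> and \<open>C^2\<close> in the plane\<close>

lemma D1_line_derivative:
  assumes "(\<lambda>t. g ((s, t0) + t *\<^sub>R (1, 0))) field_differentiable at 0"
  shows "((\<lambda>s. g (s, t0)) has_real_derivative D1 g (s, t0)) (at s)"
proof -
  have "((\<lambda>t. g ((s, t0) + t *\<^sub>R (1, 0))) has_real_derivative D1 g (s, t0)) (at 0)"
    using assms unfolding partial_deriv_def by (simp add: field_differentiable_derivI)
  then show ?thesis
    using DERIV_shift[of "\<lambda>s. g (s, t0)" "D1 g (s, t0)" 0 s] by (simp add: add.commute)
qed

lemma D2_line_derivative:
  assumes "(\<lambda>t. g ((s0, t0) + t *\<^sub>R (0, 1))) field_differentiable at 0"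
  shows "((\<lambda>t. g (s0, t)) has_real_derivative D2 g (s0, t0)) (at t0)"
proof -
  have "((\<lambda>t. g ((s0, t0) + t *\<^sub>R (0, 1))) has_real_derivative D2 g (s0, t0)) (at 0)"
    using assms unfolding partial_deriv_def by (simp add: field_differentiable_derivI)
  then show ?thesis
    using DERIV_shift[of "\<lambda>t. g (s0, t)" "D2 g (s0, t0)" 0 t0] by (simp add: add.commute)
qed

lemma Ck_on_Suc_plane:
  fixes g :: "plane \<Rightarrow> real"
  assumes "Ck_on (Suc k) S g"
  shows "Ck_on k S (D1 g)" and "Ck_on k S (D2 g)"
    and "\<And>s t. (s, t) \<in> S \<Longrightarrow> ((\<lambda>s. g (s, t)) has_real_derivative D1 g (s, t)) (at s)"
    and "\<And>s t. (s, t) \<in> S \<Longrightarrow> ((\<lambda>t. g (s, t)) has_real_derivative D2 g (s, t)) (at t)"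
proof -
  have B: "(1, 0) \<in> (Basis :: plane set)" "(0, 1) \<in> (Basis :: plane set)"
    by (auto simp: Basis_prod_def)
  have diff: "\<forall>e\<in>Basis. \<forall>x\<in>S. (\<lambda>t. g (x + t *\<^sub>R e)) field_differentiable at 0"
    using assms by simp
  show "Ck_on k S (D1 g)" "Ck_on k S (D2 g)" using assms B by auto
  show "((\<lambda>s. g (s, t)) has_real_derivative D1 g (s, t)) (at s)" if "(s, t) \<in> S" for s t
    using diff B that by (intro D1_line_derivative) blast
  show "((\<lambda>t. g (s, t)) has_real_derivative D2 g (s, t)) (at t)" if "(s, t) \<in> S" for s t
    using diff B that by (intro D2_line_derivative) blast
qed

lemma Ck_on_imp_continuous_on: "Ck_on k S g \<Longrightarrow> continuous_on S g"
  by (cases k) auto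

lemma Ck_on_Suc_D: "Ck_on (Suc k) S g \<Longrightarrow> Ck_on k S g"
  by (induction k arbitrary: g) auto

text \<open>
  The class \<open>C^k\<close> is given by partial derivatives along the axes, whereas the chain rule and the
  inverse function theorem need total derivatives. The bridge is \<open>has_derivative_partialsI\<close>, applied
  on a small square around the point, where \<open>D2 g\<close> is continuous.
\<close>

lemma C1_has_derivative:
  assumes "open S" "Ck_on 1 S g" "x \<in> S"
  shows "(g has_derivative (\<lambda>h. fst h * D1 g x + snd h * D2 g x)) (at x)"
proof -
  obtain s t where x: "x = (s, t)" by (cases x)
  have g: "Ck_on (Suc 0) S g" using assms(2) by simp
  obtain e where e: "e > 0" "ball s e \<times> ball t e \<subseteq> S"
  proof -
    from assms(1,3) x obtain A B where AB: "open A" "open B" "s \<in> A" "t \<in> B" "A \<times> B \<subseteq> S"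
      by (metis mem_Sigma_iff open_prod_elim)
    obtain d1 d2 where "d1 > 0" "ball s d1 \<subseteq> A" "d2 > 0" "ball t d2 \<subseteq> B"
      using AB by (meson open_contains_ball)
    then show ?thesis
      using AB that[of "min d1 d2"] by (auto simp: subset_iff)
  qed
  let ?X = "ball s e" and ?Y = "ball t e"
  have "((\<lambda>(p, q). g (p, q)) has_derivative
      (\<lambda>(h, k). h * D1 g x + blinfun_apply (blinfun_scaleR_left (D2 g (s, t))) k))
      (at (s, t) within ?X \<times> ?Y)"
  proof (rule has_derivative_partialsI
      [where fy = "\<lambda>p q. blinfun_scaleR_left (D2 g (p, q))"])
    show "((\<lambda>p. g (p, t)) has_derivative (\<lambda>h. h * D1 g x)) (at s within ?X)"
      using Ck_on_Suc_plane(3)[OF g, of s t] assms(3) x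
      by (intro has_derivative_at_withinI[where s = ?X])
        (simp add: has_field_derivative_def mult_commute_abs)
    show "((\<lambda>q. g (p, q)) has_derivative blinfun_apply (blinfun_scaleR_left (D2 g (p, q))))
        (at q within ?Y)" if "p \<in> ?X" "q \<in> ?Y" for p q
      using Ck_on_Suc_plane(4)[OF g, of p q] subsetD[OF e(2), of "(p, q)"] that
      by (intro has_derivative_at_withinI[where s = ?Y])
        (auto simp: has_field_derivative_def mult_commute_abs)
    have "continuous_on (?X \<times> ?Y) (D2 g)"
      using Ck_on_Suc_plane(2)[OF g] e(2) by (auto intro: continuous_on_subset)
    then have "continuous (at (s, t) within ?X \<times> ?Y) (D2 g)"
      using e(1) by (simp add: continuous_on_eq_continuous_within)
    then show "continuous (at (s, t) within ?X \<times> ?Y)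
        (\<lambda>(p, q). blinfun_scaleR_left (D2 g (p, q)))"
      by (simp add: case_prod_unfold
          bounded_linear.continuous[OF bounded_linear_blinfun_scaleR_left])
  qed (use e in auto)
  moreover have "at (s, t) within ?X \<times> ?Y = at x"
    unfolding x by (rule at_within_open) (use e(1) in \<open>auto intro: open_Times\<close>)
  ultimately show ?thesis by (simp add: case_prod_unfold x)
qed

text \<open>
  Two applications of the mean value theorem, first to the difference
  \<open>\<lambda>p. F p (t+h) - F p t\<close> and then to \<open>F1\<close> in its second argument. The left-hand side is
  unchanged when the two arguments of \<open>F\<close> are exchanged, and this is what proves Clairaut's theorem.
\<close>

lemma mixed_difference_mean_value:
  fixes F F1 F12 :: "real \<Rightarrow> real \<Rightarrow> real"
  assumes "h > 0"
    and F: "\<And>p q. p \<in> {s..s+h} \<Longrightarrow> q \<in> {t..t+h} \<Longrightarrow>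
      ((\<lambda>p. F p q) has_real_derivative F1 p q) (at p)"
    and F1: "\<And>p q. p \<in> {s..s+h} \<Longrightarrow> q \<in> {t..t+h} \<Longrightarrow>
      ((\<lambda>q. F1 p q) has_real_derivative F12 p q) (at q)"
  shows "\<exists>p\<in>{s..s+h}. \<exists>q\<in>{t..t+h}.
    F (s+h) (t+h) - F (s+h) t - F s (t+h) + F s t = h * h * F12 p q"
proof -
  have "\<exists>z>s. z < s + h \<and> (F (s+h) (t+h) - F (s+h) t) - (F s (t+h) - F s t)
      = (s + h - s) * (F1 z (t+h) - F1 z t)"
    using assms(1)
    by (intro MVT2[where f = "\<lambda>p. F p (t+h) - F p t"] DERIV_diff F) auto
  then obtain p where p: "s < p" "p < s + h"
    "(F (s+h) (t+h) - F (s+h) t) - (F s (t+h) - F s t) = h * (F1 p (t+h) - F1 p t)"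
    by auto
  have "\<exists>z>t. z < t + h \<and> F1 p (t+h) - F1 p t = (t + h - t) * F12 p z"
    using assms(1) p by (intro MVT2 F1) auto
  then obtain q where "t < q" "q < t + h" "F1 p (t+h) - F1 p t = h * F12 p q"
    by auto
  with p show ?thesis by (intro bexI[of _ p] bexI[of _ q]) auto
qed

text \<open>
  Clairaut's theorem. The mixed difference of \<open>g\<close> over a small square, divided by the area, is a
  value of either mixed derivative at some point of the square. If the two derivatives differed at
  \<open>x\<close>, continuity would keep their values apart on a sufficiently small square.
\<close>

lemma C2_mixed_partials_commute:
  assumes "open S" "Ck_on 2 S g" "x \<in> S"
  shows "D1 (D2 g) x = D2 (D1 g) x"
proof (rule ccontr)
  assume ne: "D1 (D2 g) x \<noteq> D2 (D1 g) x"
  \<comment> \<open>Half the gap: values within \<open>e\<close> of the two sides cannot coincide.\<close>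
  define e where "e = \<bar>D1 (D2 g) x - D2 (D1 g) x\<bar> / 2"
  have "e > 0" using ne by (simp add: e_def)
  obtain s t where x: "x = (s, t)" by (cases x)
  have g: "Ck_on (Suc (Suc 0)) S g" using assms(2) by (simp add: numeral_2_eq_2)
  note d = Ck_on_Suc_plane[OF g]
  have "isCont (D1 (D2 g)) x" "isCont (D2 (D1 g)) x"
    using Ck_on_Suc_plane(1)[OF d(2)] Ck_on_Suc_plane(2)[OF d(1)] assms
    by (auto simp: continuous_on_eq_continuous_at)
  then have "(D1 (D2 g) \<longlongrightarrow> D1 (D2 g) x) (nhds x)" "(D2 (D1 g) \<longlongrightarrow> D2 (D1 g) x) (nhds x)"
    by (simp_all add: isCont_def tendsto_at_iff_tendsto_nhds)
  then have "\<forall>\<^sub>F y in nhds x. dist (D1 (D2 g) y) (D1 (D2 g) x) < e \<and>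
      dist (D2 (D1 g) y) (D2 (D1 g) x) < e \<and> y \<in> S"
    using \<open>e > 0\<close> assms
    by (intro eventually_conj tendstoD eventually_nhds_in_open) auto
  then obtain d where "d > 0" and near: "\<And>y. dist y x < d \<Longrightarrow>
      dist (D1 (D2 g) y) (D1 (D2 g) x) < e \<and> dist (D2 (D1 g) y) (D2 (D1 g) x) < e \<and> y \<in> S"
    unfolding eventually_nhds_metric by auto
  \<comment> \<open>A square of side \<open>d / 3\<close> with corner \<open>x\<close> stays within distance \<open>2 d / 3\<close> of \<open>x\<close>.\<close>
  define h where "h = d / 3"
  have "h > 0" using \<open>d > 0\<close> by (simp add: h_def)
  have box: "dist (p, q) x < d" if "p \<in> {s..s+h}" "q \<in> {t..t+h}" for p q
  proof -
    have "dist (p, q) x \<le> dist p s + dist q t"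
      unfolding x dist_Pair_Pair by (intro sqrt_sum_squares_le_sum) auto
    also have "\<dots> < d" using that \<open>d > 0\<close> by (auto simp: dist_real_def h_def)
    finally show ?thesis .
  qed
  obtain p q where pq: "p \<in> {s..s+h}" "q \<in> {t..t+h}"
      "g (s+h, t+h) - g (s+h, t) - g (s, t+h) + g (s, t) = h * h * D2 (D1 g) (p, q)"
    using mixed_difference_mean_value[of h s t "\<lambda>p q. g (p, q)" "\<lambda>p q. D1 g (p, q)"
        "\<lambda>p q. D2 (D1 g) (p, q)"] \<open>h > 0\<close> d(3) Ck_on_Suc_plane(4)[OF d(1)] near box
    by auto
  \<comment> \<open>The same difference, now with the second argument of \<open>g\<close> varied first.\<close>
  obtain q' p' where pq': "p' \<in> {s..s+h}" "q' \<in> {t..t+h}"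
      "g (s+h, t+h) - g (s, t+h) - g (s+h, t) + g (s, t) = h * h * D1 (D2 g) (p', q')"
    using mixed_difference_mean_value[of h t s "\<lambda>q p. g (p, q)" "\<lambda>q p. D2 g (p, q)"
        "\<lambda>q p. D1 (D2 g) (p, q)"] \<open>h > 0\<close> d(4) Ck_on_Suc_plane(3)[OF d(2)] near box
    by auto
  have "h * h * D2 (D1 g) (p, q) = h * h * D1 (D2 g) (p', q')"
    using pq(3) pq'(3) by linarith
  then have "D2 (D1 g) (p, q) = D1 (D2 g) (p', q')" using \<open>h > 0\<close> by simp
  then show False
    using near[OF box[OF pq(1,2)]] near[OF box[OF pq'(1,2)]]
    unfolding e_def dist_real_def by (auto simp: abs_if field_simps split: if_splits)
qed

section \<open>The inverse of the change of variables\<close>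

lemma partial_deriv_eq_derivative:
  assumes "(g has_derivative g') (at x)"
  shows "partial_deriv e g x = g' e"
proof -
  have "((\<lambda>t. x + t *\<^sub>R e) has_derivative (\<lambda>t. t *\<^sub>R e)) (at 0)"
    by (auto intro!: derivative_eq_intros)
  from has_derivative_compose[OF this, of g g'] assms
  have "((\<lambda>t. g (x + t *\<^sub>R e)) has_derivative (\<lambda>t. g' (t *\<^sub>R e))) (at 0)"
    by simp
  moreover have "g' (t *\<^sub>R e) = g' e * t" for t
    using linear_cmul[OF has_derivative_linear[OF assms], of t e] by simp
  ultimately have "((\<lambda>t. g (x + t *\<^sub>R e)) has_real_derivative g' e) (at 0)"
    by (simp add: has_field_derivative_def)
  then show ?thesis unfolding partial_deriv_def by (rule DERIV_imp_deriv)
qed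

text \<open>
  The derivative of the inverse map is the inverse of the Jacobian matrix of \<open>(\<gamma>1, \<gamma>2)\<close>, written out
  by Cramer's rule. As \<open>char_map \<gamma>1 \<gamma>2\<close> is continuous and injective on an open set, the inverse is
  automatically continuous.
\<close>

lemma char_inv_has_derivative:
  assumes "open \<Omega>" "Ck_on 1 \<Omega> \<gamma>1" "Ck_on 1 \<Omega> \<gamma>2"
    and "jacobian_det \<gamma>1 \<gamma>2 x \<noteq> 0" "inj_on (char_map \<gamma>1 \<gamma>2) \<Omega>" "x \<in> \<Omega>"
  shows "(char_inv \<Omega> \<gamma>1 \<gamma>2 has_derivative
      (\<lambda>k. ((D2 \<gamma>2 x * fst k - D2 \<gamma>1 x * snd k) / jacobian_det \<gamma>1 \<gamma>2 x,
            (D1 \<gamma>1 x * snd k - D1 \<gamma>2 x * fst k) / jacobian_det \<gamma>1 \<gamma>2 x)))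
    (at (char_map \<gamma>1 \<gamma>2 x))"
proof (rule has_derivative_inverse_strong[OF assms(1) assms(6)])
  show "continuous_on \<Omega> (char_map \<gamma>1 \<gamma>2)"
    using assms(2,3) unfolding char_map_def [abs_def]
    by (intro continuous_on_Pair Ck_on_imp_continuous_on)
  show "char_inv \<Omega> \<gamma>1 \<gamma>2 (char_map \<gamma>1 \<gamma>2 x) = x" if "x \<in> \<Omega>" for x
    using that assms(5) by (simp add: char_inv_def)
  show "(char_map \<gamma>1 \<gamma>2 has_derivative
      (\<lambda>h. (fst h * D1 \<gamma>1 x + snd h * D2 \<gamma>1 x, fst h * D1 \<gamma>2 x + snd h * D2 \<gamma>2 x))) (at x)"
    using assms unfolding char_map_def [abs_def]
    by (intro has_derivative_Pair C1_has_derivative)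
  show "(\<lambda>h. (fst h * D1 \<gamma>1 x + snd h * D2 \<gamma>1 x, fst h * D1 \<gamma>2 x + snd h * D2 \<gamma>2 x)) \<circ>
      (\<lambda>k. ((D2 \<gamma>2 x * fst k - D2 \<gamma>1 x * snd k) / jacobian_det \<gamma>1 \<gamma>2 x,
            (D1 \<gamma>1 x * snd k - D1 \<gamma>2 x * fst k) / jacobian_det \<gamma>1 \<gamma>2 x)) = id"
    using assms(4)
    by (auto simp: fun_eq_iff field_simps) (simp_all add: jacobian_det_def algebra_simps)
qed

section \<open>The canonical form of the equation\<close>

text \<open>
  Up to the factor 2, \<open>\<beta>\<close> is the off-diagonal entry of the quadratic form of \<open>\<A>\<close>
  in the basis \<open>\<nabla>\<gamma>1, \<nabla>\<gamma>2\<close>, whose diagonal entries vanish along characteristics. A change of basis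
  multiplies the determinant \<open>a c - b\<^sup>2\<close> by the squared Jacobian, so
  \<open>(\<beta>/2)\<^sup>2 = (b\<^sup>2 - a c) J\<^sup>2 > 0\<close>.
\<close>

lemma char_beta_nonzero:
  assumes "first_integral \<Omega> a b c \<gamma>1" "first_integral \<Omega> a b c \<gamma>2" "x \<in> \<Omega>"
    and "(b x)\<^sup>2 - a x * c x > 0" "jacobian_det \<gamma>1 \<gamma>2 x \<noteq> 0"
  shows "char_beta a b c \<gamma>1 \<gamma>2 x \<noteq> 0"
proof
  assume "char_beta a b c \<gamma>1 \<gamma>2 x = 0"
  define Q where "Q p q = a x * p\<^sup>2 + 2 * b x * p * q + c x * q\<^sup>2" for p q
  have "(char_beta a b c \<gamma>1 \<gamma>2 x)\<^sup>2 =
      4 * (((b x)\<^sup>2 - a x * c x) * (jacobian_det \<gamma>1 \<gamma>2 x)\<^sup>2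
        + Q (D1 \<gamma>1 x) (D2 \<gamma>1 x) * Q (D1 \<gamma>2 x) (D2 \<gamma>2 x))"
    unfolding char_beta_def jacobian_det_def Q_def by algebra
  moreover have "Q (D1 \<gamma>1 x) (D2 \<gamma>1 x) = 0"
    using assms(1,3) by (simp add: first_integral_def Q_def)
  ultimately show False
    using assms(4,5) \<open>char_beta a b c \<gamma>1 \<gamma>2 x = 0\<close> by simp
qed

text \<open>
  The derivatives with respect to the characteristic coordinates \<open>y1\<close> and \<open>y2\<close>, expressed as functions
  of \<open>x\<close>: the solution of \<open>\<nabla>u = char_D1 \<nabla>\<gamma>1 + char_D2 \<nabla>\<gamma>2\<close> by Cramer's rule. Since they do
  not mention the inverse map, they can be differentiated in \<open>x\<close> as soon as \<open>u, \<gamma>1, \<gamma>2\<close> are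
  of class \<open>C^2\<close>.
\<close>

definition char_D1 :: "(plane \<Rightarrow> real) \<Rightarrow> (plane \<Rightarrow> real) \<Rightarrow> (plane \<Rightarrow> real) \<Rightarrow> plane \<Rightarrow> real" where
  "char_D1 \<gamma>1 \<gamma>2 u x = (D1 u x * D2 \<gamma>2 x - D2 u x * D1 \<gamma>2 x) / jacobian_det \<gamma>1 \<gamma>2 x"

definition char_D2 :: "(plane \<Rightarrow> real) \<Rightarrow> (plane \<Rightarrow> real) \<Rightarrow> (plane \<Rightarrow> real) \<Rightarrow> plane \<Rightarrow> real" where
  "char_D2 \<gamma>1 \<gamma>2 u x = (D2 u x * D1 \<gamma>1 x - D1 u x * D2 \<gamma>1 x) / jacobian_det \<gamma>1 \<gamma>2 x"

text \<open>
  This justifies the reading of \<open>char_D1\<close> and \<open>char_D2\<close> as derivatives in the characteristic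
  coordinates. The function \<open>w\<close> is arbitrary because two instances are used: \<open>u\<close> for the first
  derivative, and \<open>char_D1 \<gamma>1 \<gamma>2 u\<close> for the mixed one.
\<close>

lemma characteristic_chain_rule:
  assumes "open \<Omega>" "Ck_on 1 \<Omega> \<gamma>1" "Ck_on 1 \<Omega> \<gamma>2"
    and "jacobian_det \<gamma>1 \<gamma>2 x \<noteq> 0" "inj_on (char_map \<gamma>1 \<gamma>2) \<Omega>" "x \<in> \<Omega>"
    and "w differentiable (at x)"
    and z: "char_map \<gamma>1 \<gamma>2 x = (z1, z2)"
  shows "((\<lambda>s. w (char_inv \<Omega> \<gamma>1 \<gamma>2 (s, z2))) has_real_derivative char_D1 \<gamma>1 \<gamma>2 w x) (at z1)"
    and "((\<lambda>t. w (char_inv \<Omega> \<gamma>1 \<gamma>2 (z1, t))) has_real_derivative char_D2 \<gamma>1 \<gamma>2 w x) (at z2)"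
proof -
  let ?G = "char_inv \<Omega> \<gamma>1 \<gamma>2" and ?J = "jacobian_det \<gamma>1 \<gamma>2 x"
  obtain w' where w': "(w has_derivative w') (at x)"
    using assms(7) by (auto simp: differentiable_def)
  have w'_eq: "w' (h, k) = h * D1 w x + k * D2 w x" for h k
  proof -
    have "w' (h, k) = w' (h *\<^sub>R (1, 0) + k *\<^sub>R (0, 1))" by simp
    also have "\<dots> = h * w' (1, 0) + k * w' (0, 1)"
      using has_derivative_linear[OF w'] by (simp only: linear_add linear_cmul real_scaleR_def)
    finally show ?thesis by (simp add: partial_deriv_eq_derivative[OF w'])
  qed
  have Gx: "?G (z1, z2) = x" using assms(5,6) z[symmetric] by (simp add: char_inv_def)
  have G: "(?G has_derivative
      (\<lambda>k. ((D2 \<gamma>2 x * fst k - D2 \<gamma>1 x * snd k) / ?J, (D1 \<gamma>1 x * snd k - D1 \<gamma>2 x * fst k) / ?J)))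
      (at (z1, z2))"
    using char_inv_has_derivative[OF assms(1-6)] z by simp
  have wG: "((\<lambda>y. w (?G y)) has_derivative
      (\<lambda>k. w' ((D2 \<gamma>2 x * fst k - D2 \<gamma>1 x * snd k) / ?J, (D1 \<gamma>1 x * snd k - D1 \<gamma>2 x * fst k) / ?J)))
      (at (z1, z2))"
    using has_derivative_compose[OF G, of w w'] w' Gx by simp
  have "((\<lambda>s. (s, z2)) has_derivative (\<lambda>h. (h, 0))) (at z1)"
    by (auto intro!: derivative_eq_intros)
  from has_derivative_compose[OF this wG]
  show "((\<lambda>s. w (?G (s, z2))) has_real_derivative char_D1 \<gamma>1 \<gamma>2 w x) (at z1)"
    unfolding has_field_derivative_def
    by (rule has_derivative_eq_rhs)
      (use assms(4) in \<open>auto simp: w'_eq char_D1_def fun_eq_iff field_simps\<close>)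
  have "((\<lambda>t. (z1, t)) has_derivative (\<lambda>h. (0, h))) (at z2)"
    by (auto intro!: derivative_eq_intros)
  from has_derivative_compose[OF this wG]
  show "((\<lambda>t. w (?G (z1, t))) has_real_derivative char_D2 \<gamma>1 \<gamma>2 w x) (at z2)"
    unfolding has_field_derivative_def
    by (rule has_derivative_eq_rhs)
      (use assms(4) in \<open>auto simp: w'_eq char_D2_def fun_eq_iff field_simps\<close>)
qed

lemma C2_differentiable:
  assumes "open S" "Ck_on 2 S g" "x \<in> S"
  shows "g differentiable (at x)" "D1 g differentiable (at x)" "D2 g differentiable (at x)"
proof -
  have g: "Ck_on (Suc 1) S g" using assms(2) by (simp add: numeral_2_eq_2)
  show "g differentiable (at x)" "D1 g differentiable (at x)" "D2 g differentiable (at x)"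
    using C1_has_derivative[OF assms(1) Ck_on_Suc_D[OF g] assms(3)]
      C1_has_derivative[OF assms(1) Ck_on_Suc_plane(1)[OF g] assms(3)]
      C1_has_derivative[OF assms(1) Ck_on_Suc_plane(2)[OF g] assms(3)]
    by (auto simp: differentiable_def)
qed

lemma char_derivatives_differentiable:
  assumes "open \<Omega>" "Ck_on 2 \<Omega> \<gamma>1" "Ck_on 2 \<Omega> \<gamma>2" "Ck_on 2 \<Omega> u" "x \<in> \<Omega>"
    and "jacobian_det \<gamma>1 \<gamma>2 x \<noteq> 0"
  shows "char_D1 \<gamma>1 \<gamma>2 u differentiable (at x)" "char_D2 \<gamma>1 \<gamma>2 u differentiable (at x)"
  using assms(6) C2_differentiable[OF assms(1,2,5)] C2_differentiable[OF assms(1,3,5)]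
    C2_differentiable[OF assms(1,4,5)]
  unfolding char_D1_def [abs_def] char_D2_def [abs_def] jacobian_det_def [abs_def]
  by (auto intro!: differentiable_divide differentiable_diff differentiable_mult)

lemma partial_deriv_sum_of_products:
  assumes "open S" "x \<in> S" "\<And>y. y \<in> S \<Longrightarrow> g y = w y * p y + v y * q y"
    and "w differentiable (at x)" "p differentiable (at x)"
      "v differentiable (at x)" "q differentiable (at x)"
  shows "partial_deriv e g x =
    partial_deriv e w x * p x + w x * partial_deriv e p x
    + partial_deriv e v x * q x + v x * partial_deriv e q x"
proof -
  obtain w' p' v' q' where d: "(w has_derivative w') (at x)" "(p has_derivative p') (at x)"
      "(v has_derivative v') (at x)" "(q has_derivative q') (at x)"
    using assms(4-7) by (auto simp: differentiable_def)
  have "((\<lambda>y. w y * p y + v y * q y) has_derivative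
      (\<lambda>h. w x * p' h + w' h * p x + (v x * q' h + v' h * q x))) (at x)"
    by (intro has_derivative_add has_derivative_mult d)
  then have "(g has_derivative
      (\<lambda>h. w x * p' h + w' h * p x + (v x * q' h + v' h * q x))) (at x)"
    by (rule has_derivative_transform_within_open[OF _ assms(1,2)]) (simp add: assms(3))
  from partial_deriv_eq_derivative[OF this] show ?thesis
    by (simp add: d[THEN partial_deriv_eq_derivative])
qed

text \<open>
  Differentiating \<open>\<nabla>u = v\<^sub>1 \<nabla>\<gamma>1 + v\<^sub>2 \<nabla>\<gamma>2\<close> expresses the second derivatives of \<open>u\<close> through those of
  \<open>\<gamma>1, \<gamma>2\<close> and the gradients of \<open>v\<^sub>1, v\<^sub>2\<close>; these gradients are decomposed along
  \<open>\<nabla>\<gamma>1, \<nabla>\<gamma>2\<close> once more. The rest is algebra at the point \<open>x\<close>, with the vanishing of the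
  characteristic forms removing the pure second derivatives in characteristic coordinates.
\<close>

lemma canonical_form:
  assumes \<Omega>: "open \<Omega>" "x \<in> \<Omega>"
    and C2: "Ck_on 2 \<Omega> \<gamma>1" "Ck_on 2 \<Omega> \<gamma>2" "Ck_on 2 \<Omega> u"
    and J: "\<forall>x\<in>\<Omega>. jacobian_det \<gamma>1 \<gamma>2 x \<noteq> 0"
    and fi: "first_integral \<Omega> a b c \<gamma>1" "first_integral \<Omega> a b c \<gamma>2"
  shows "op_A a b c u x = char_beta a b c \<gamma>1 \<gamma>2 x * char_D2 \<gamma>1 \<gamma>2 (char_D1 \<gamma>1 \<gamma>2 u) x
    + op_A a b c \<gamma>1 x * char_D1 \<gamma>1 \<gamma>2 u x + op_A a b c \<gamma>2 x * char_D2 \<gamma>1 \<gamma>2 u x"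
proof -
  let ?w = "char_D1 \<gamma>1 \<gamma>2 u" and ?v = "char_D2 \<gamma>1 \<gamma>2 u" and ?J = "jacobian_det \<gamma>1 \<gamma>2 x"
  \<comment> \<open>The second derivatives \<open>v\<^sub>1\<^sub>1, v\<^sub>1\<^sub>2, v\<^sub>2\<^sub>1, v\<^sub>2\<^sub>2\<close> in characteristic coordinates.\<close>
  define W1 W2 V1 V2 where W: "W1 = char_D1 \<gamma>1 \<gamma>2 ?w x" "W2 = char_D2 \<gamma>1 \<gamma>2 ?w x"
    "V1 = char_D1 \<gamma>1 \<gamma>2 ?v x" "V2 = char_D2 \<gamma>1 \<gamma>2 ?v x"
  have J0: "?J \<noteq> 0" using J \<Omega>(2) by blast
  have cramer1: "D1 g y = char_D1 \<gamma>1 \<gamma>2 g y * D1 \<gamma>1 y + char_D2 \<gamma>1 \<gamma>2 g y * D1 \<gamma>2 y"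
    and cramer2: "D2 g y = char_D1 \<gamma>1 \<gamma>2 g y * D2 \<gamma>1 y + char_D2 \<gamma>1 \<gamma>2 g y * D2 \<gamma>2 y"
    if "y \<in> \<Omega>" for g y
  proof -
    have "jacobian_det \<gamma>1 \<gamma>2 y \<noteq> 0" using J that by blast
    then show "D1 g y = char_D1 \<gamma>1 \<gamma>2 g y * D1 \<gamma>1 y + char_D2 \<gamma>1 \<gamma>2 g y * D1 \<gamma>2 y"
      and "D2 g y = char_D1 \<gamma>1 \<gamma>2 g y * D2 \<gamma>1 y + char_D2 \<gamma>1 \<gamma>2 g y * D2 \<gamma>2 y"
      unfolding char_D1_def char_D2_def
      by (simp_all add: field_simps) (simp_all add: jacobian_det_def algebra_simps)
  qed
  note dw = char_derivatives_differentiable[OF \<Omega>(1) C2 \<Omega>(2) J0]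
  note d1 = C2_differentiable[OF \<Omega>(1) C2(1) \<Omega>(2)] and d2 = C2_differentiable[OF \<Omega>(1) C2(2) \<Omega>(2)]
  have u1: "partial_deriv e (D1 u) x = partial_deriv e ?w x * D1 \<gamma>1 x + ?w x * partial_deriv e (D1 \<gamma>1) x
      + partial_deriv e ?v x * D1 \<gamma>2 x + ?v x * partial_deriv e (D1 \<gamma>2) x" for e
    by (rule partial_deriv_sum_of_products[OF \<Omega> cramer1 dw(1) d1(2) dw(2) d2(2)])
  have u2: "partial_deriv e (D2 u) x = partial_deriv e ?w x * D2 \<gamma>1 x + ?w x * partial_deriv e (D2 \<gamma>1) x
      + partial_deriv e ?v x * D2 \<gamma>2 x + ?v x * partial_deriv e (D2 \<gamma>2) x" for e
    by (rule partial_deriv_sum_of_products[OF \<Omega> cramer2 dw(1) d1(3) dw(2) d2(3)])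
  note wv = cramer1[OF \<Omega>(2), of ?w, folded W] cramer2[OF \<Omega>(2), of ?w, folded W]
    cramer1[OF \<Omega>(2), of ?v, folded W] cramer2[OF \<Omega>(2), of ?v, folded W]
  have "D1 (D2 u) x = D2 (D1 u) x" "D1 (D2 \<gamma>1) x = D2 (D1 \<gamma>1) x" "D1 (D2 \<gamma>2) x = D2 (D1 \<gamma>2) x"
    using C2_mixed_partials_commute[OF \<Omega>(1) _ \<Omega>(2)] C2 by auto
  \<comment> \<open>The difference of the two mixed derivatives of \<open>u\<close> is \<open>W2 - V1\<close> times the Jacobian, up to
    sign, because the terms with second derivatives of \<open>\<gamma>1\<close> and \<open>\<gamma>2\<close> cancel.\<close>
  then have "(W2 - V1) * ?J = 0"
    unfolding u1 u2 wv jacobian_det_def by algebra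
  then have sym: "V1 = W2" using J0 by simp
  have "a x * (D1 \<gamma>1 x)\<^sup>2 + 2 * b x * D1 \<gamma>1 x * D2 \<gamma>1 x + c x * (D2 \<gamma>1 x)\<^sup>2 = 0"
    "a x * (D1 \<gamma>2 x)\<^sup>2 + 2 * b x * D1 \<gamma>2 x * D2 \<gamma>2 x + c x * (D2 \<gamma>2 x)\<^sup>2 = 0"
    using fi \<Omega>(2) by (auto simp: first_integral_def)
  \<comment> \<open>As \<open>V1 = W2\<close>, the two mixed terms combine to \<open>\<beta> W2\<close>.\<close>
  then show ?thesis
    unfolding W(2)[symmetric] op_A_def u1 u2 wv char_beta_def sym by algebra
qed

section \<open>Integration over a characteristic parallelogram\<close>

text \<open>
  The brackets \<open>q \<partial>\<^sub>j g1 + r \<partial>\<^sub>j g2\<close> in \<open>char_K\<close>, taken at \<open>q = D1 u x\<close> and \<open>r = D2 u x\<close>, are the chain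
  rule for the derivatives of \<open>u\<close> in the characteristic coordinates, that is, \<open>char_D1\<close> and \<open>char_D2\<close>.
  So \<open>char_Ktilde\<close> is the canonical form solved for the mixed derivative.
\<close>

lemma char_Ktilde_eq_mixed_derivative:
  assumes \<Omega>: "open \<Omega>" "x \<in> \<Omega>" and z: "char_map \<gamma>1 \<gamma>2 x = z"
    and C2: "Ck_on 2 \<Omega> \<gamma>1" "Ck_on 2 \<Omega> \<gamma>2" "Ck_on 2 \<Omega> u"
    and J: "\<forall>x\<in>\<Omega>. jacobian_det \<gamma>1 \<gamma>2 x \<noteq> 0"
    and inj: "inj_on (char_map \<gamma>1 \<gamma>2) \<Omega>"
    and fi: "first_integral \<Omega> a b c \<gamma>1" "first_integral \<Omega> a b c \<gamma>2"
    and hyp: "(b x)\<^sup>2 - a x * c x > 0"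
    and eq: "op_A a b c u x = f (x, u x, D1 u x, D2 u x)"
  shows "char_Ktilde \<Omega> a b c f \<gamma>1 \<gamma>2 z (u x) (D1 u x) (D2 u x)
    = char_D2 \<gamma>1 \<gamma>2 (char_D1 \<gamma>1 \<gamma>2 u) x"
proof -
  let ?g1 = "char_inv1 \<Omega> \<gamma>1 \<gamma>2" and ?g2 = "char_inv2 \<Omega> \<gamma>1 \<gamma>2" and ?J = "jacobian_det \<gamma>1 \<gamma>2 x"
  have C1: "Ck_on 1 \<Omega> \<gamma>1" "Ck_on 1 \<Omega> \<gamma>2"
    using C2 Ck_on_Suc_D[of 1] by (auto simp: numeral_2_eq_2)
  have J0: "?J \<noteq> 0" using J \<Omega>(2) by blast
  have Gz: "(?g1 z, ?g2 z) = x"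
    using inj \<Omega>(2) z[symmetric] by (simp add: char_inv1_def char_inv2_def char_inv_def)
  note G = char_inv_has_derivative[OF \<Omega>(1) C1 J0 inj \<Omega>(2), unfolded z]
  have g1: "(?g1 has_derivative (\<lambda>k. (D2 \<gamma>2 x * fst k - D2 \<gamma>1 x * snd k) / ?J)) (at z)"
    using has_derivative_fst[OF G] unfolding char_inv1_def [abs_def] by simp
  have g2: "(?g2 has_derivative (\<lambda>k. (D1 \<gamma>1 x * snd k - D1 \<gamma>2 x * fst k) / ?J)) (at z)"
    using has_derivative_snd[OF G] unfolding char_inv2_def [abs_def] by simp
  have "D1 u x * D1 ?g1 z + D2 u x * D1 ?g2 z = char_D1 \<gamma>1 \<gamma>2 u x"
    "D1 u x * D2 ?g1 z + D2 u x * D2 ?g2 z = char_D2 \<gamma>1 \<gamma>2 u x"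
    using J0 by (simp_all add: g1[THEN partial_deriv_eq_derivative]
        g2[THEN partial_deriv_eq_derivative] char_D1_def char_D2_def field_simps)
  moreover have "char_beta a b c \<gamma>1 \<gamma>2 x \<noteq> 0"
    by (rule char_beta_nonzero[OF fi \<Omega>(2) hyp J0])
  ultimately show ?thesis
    using canonical_form[OF \<Omega> C2 J fi]
    by (simp add: char_Ktilde_def char_K_def Let_def Gz eq[symmetric])
qed

text \<open>
  The fundamental theorem of calculus, first in \<open>t\<close> and then in \<open>s\<close>. Pointwise derivatives suffice,
  since the gauge integral integrates every derivative.
\<close>

lemma integral_mixed_derivative:
  fixes v v1 v12 :: "real \<Rightarrow> real \<Rightarrow> real"
  assumes "l1 \<le> l2" "r1 \<le> r2"
    and v: "\<And>s t. s \<in> {l1..l2} \<Longrightarrow> t \<in> {r1..r2} \<Longrightarrow>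
      ((\<lambda>s. v s t) has_real_derivative v1 s t) (at s)"
    and v1: "\<And>s t. s \<in> {l1..l2} \<Longrightarrow> t \<in> {r1..r2} \<Longrightarrow>
      ((\<lambda>t. v1 s t) has_real_derivative v12 s t) (at t)"
  shows "integral {l1..l2} (\<lambda>s. integral {r1..r2} (v12 s)) = v l1 r1 - v l1 r2 + v l2 r2 - v l2 r1"
proof -
  have inner: "integral {r1..r2} (v12 s) = v1 s r2 - v1 s r1" if "s \<in> {l1..l2}" for s
    using that assms(2) v1
    by (intro integral_unique fundamental_theorem_of_calculus)
      (simp_all add: has_real_derivative_iff_has_vector_derivative[symmetric]
        has_field_derivative_at_within)
  have "((\<lambda>s. v1 s r2 - v1 s r1) has_integral (v l2 r2 - v l2 r1) - (v l1 r2 - v l1 r1)) {l1..l2}"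
    using assms(1,2) v
    by (intro fundamental_theorem_of_calculus)
      (simp_all add: has_real_derivative_iff_has_vector_derivative[symmetric]
        has_field_derivative_at_within DERIV_diff)
  moreover have "integral {l1..l2} (\<lambda>s. integral {r1..r2} (v12 s))
      = integral {l1..l2} (\<lambda>s. v1 s r2 - v1 s r1)"
    using inner by (intro integral_cong) auto
  ultimately show ?thesis by (simp add: integral_unique)
qed

theorem theorem4p1:
  fixes \<Omega> P :: "(real \<times> real) set"
    and a b c \<gamma>1 \<gamma>2 u g1 g2 :: "real \<times> real \<Rightarrow> real"
    and f :: "(real \<times> real) \<times> real \<times> real \<times> real \<Rightarrow> real"
    and l1 l2 r1 r2 :: real
    and A B C D :: "real \<times> real"
  assumes "open \<Omega>" and "connected \<Omega>"
    and "Ck_on 2 \<Omega> a" and "Ck_on 2 \<Omega> b" and "Ck_on 2 \<Omega> c"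
    and "Ck_on 1 (\<Omega> \<times> UNIV) f"
    and "\<forall>x\<in>\<Omega>. (b x)\<^sup>2 - a x * c x > 0"
    and "Ck_on 2 \<Omega> \<gamma>1" and "Ck_on 2 \<Omega> \<gamma>2"
    and "first_integral \<Omega> a b c \<gamma>1" and "first_integral \<Omega> a b c \<gamma>2"
    and "\<forall>x\<in>\<Omega>. jacobian_det \<gamma>1 \<gamma>2 x \<noteq> 0"
    and "inj_on (char_map \<gamma>1 \<gamma>2) \<Omega>"
    and "g1 = char_inv1 \<Omega> \<gamma>1 \<gamma>2" and "g2 = char_inv2 \<Omega> \<gamma>1 \<gamma>2"
    and "Ck_on 2 \<Omega> u"
    and "\<forall>x\<in>\<Omega>. op_A a b c u x = f (x, u x, D1 u x, D2 u x)"
    and "char_parallelogram \<Omega> \<gamma>1 \<gamma>2 l1 l2 r1 r2 P"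
    and "A = (g1 (l1, r1), g2 (l1, r1))" and "B = (g1 (l1, r2), g2 (l1, r2))"
    and "C = (g1 (l2, r2), g2 (l2, r2))" and "D = (g1 (l2, r1), g2 (l2, r1))"
  shows "u A - u B + u C - u D =
    integral {l1..l2} (\<lambda>z1. integral {r1..r2} (\<lambda>z2.
      char_Ktilde \<Omega> a b c f \<gamma>1 \<gamma>2 (z1, z2)
        (u (g1 (z1, z2), g2 (z1, z2)))
        (D1 u (g1 (z1, z2), g2 (z1, z2)))
        (D2 u (g1 (z1, z2), g2 (z1, z2)))))"
proof -
  let ?G = "char_inv \<Omega> \<gamma>1 \<gamma>2" and ?w = "char_D1 \<gamma>1 \<gamma>2 u"
  have G: "(g1 z, g2 z) = ?G z" for z
    unfolding assms(14,15) char_inv1_def char_inv2_def by simp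
  have C1: "Ck_on 1 \<Omega> \<gamma>1" "Ck_on 1 \<Omega> \<gamma>2"
    using assms(8,9) Ck_on_Suc_D[of 1] by (auto simp: numeral_2_eq_2)
  have lr: "l1 < l2" "r1 < r2" and im: "{l1..l2} \<times> {r1..r2} \<subseteq> char_map \<gamma>1 \<gamma>2 ` \<Omega>"
    using assms(18) by (auto simp: char_parallelogram_def)
  have inv: "?G (s, t) \<in> \<Omega>" "char_map \<gamma>1 \<gamma>2 (?G (s, t)) = (s, t)"
    if "s \<in> {l1..l2}" "t \<in> {r1..r2}" for s t
    using im that unfolding char_inv_def by (auto intro!: inv_into_into f_inv_into_f)
  have v: "((\<lambda>s. u (?G (s, t))) has_real_derivative ?w (?G (s, t))) (at s)"
    and v1: "((\<lambda>t. ?w (?G (s, t))) has_real_derivative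
        char_D2 \<gamma>1 \<gamma>2 ?w (?G (s, t))) (at t)"
    and K: "char_Ktilde \<Omega> a b c f \<gamma>1 \<gamma>2 (s, t) (u (?G (s, t))) (D1 u (?G (s, t))) (D2 u (?G (s, t)))
        = char_D2 \<gamma>1 \<gamma>2 ?w (?G (s, t))"
    if st: "s \<in> {l1..l2}" "t \<in> {r1..r2}" for s t
  proof -
    note x = inv[OF st]
    have J: "jacobian_det \<gamma>1 \<gamma>2 (?G (s, t)) \<noteq> 0" using assms(12) x(1) by blast
    note chain = characteristic_chain_rule[OF assms(1) C1 J assms(13) x(1) _ x(2)]
    show "((\<lambda>s. u (?G (s, t))) has_real_derivative ?w (?G (s, t))) (at s)"
      by (rule chain(1)[OF C2_differentiable(1)[OF assms(1,16) x(1)]])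
    show "((\<lambda>t. ?w (?G (s, t))) has_real_derivative
        char_D2 \<gamma>1 \<gamma>2 ?w (?G (s, t))) (at t)"
      by (rule chain(2)[OF char_derivatives_differentiable(1)[OF assms(1,8,9,16) x(1) J]])
    show "char_Ktilde \<Omega> a b c f \<gamma>1 \<gamma>2 (s, t) (u (?G (s, t))) (D1 u (?G (s, t))) (D2 u (?G (s, t)))
        = char_D2 \<gamma>1 \<gamma>2 ?w (?G (s, t))"
      using assms(7,17) x(1)
      by (intro char_Ktilde_eq_mixed_derivative[OF assms(1) x assms(8,9,16,12,13,10,11)]) auto
  qed
  have "u A - u B + u C - u D =
      integral {l1..l2} (\<lambda>s. integral {r1..r2} (\<lambda>t. char_D2 \<gamma>1 \<gamma>2 ?w (?G (s, t))))"
    unfolding assms(19-22) G using lr v v1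
    by (subst integral_mixed_derivative[where v = "\<lambda>s t. u (?G (s, t))"]) auto
  also have "\<dots> = integral {l1..l2} (\<lambda>z1. integral {r1..r2} (\<lambda>z2.
      char_Ktilde \<Omega> a b c f \<gamma>1 \<gamma>2 (z1, z2)
        (u (g1 (z1, z2), g2 (z1, z2)))
        (D1 u (g1 (z1, z2), g2 (z1, z2)))
        (D2 u (g1 (z1, z2), g2 (z1, z2)))))"
    unfolding G using K by (intro integral_cong) auto
  finally show ?thesis .
qed

end
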